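(* Let $B=\{(b_i,d_i)\}_{i=1}^n$ and $B'=\{(b_i',d_i')\}_{i=1}^n$ be fundamentally strict barcodes with $n$ bars. If $g_k(B)=g_k(B')$ for all $k\in\mathbb{N}$ and the interval graph $G_B$ (equivalently $G_{B'}$) is connected, then there exist constants $\alpha>0$ and $\delta\in\mathbb{R}$ such that $B=\alpha B'+\delta$ (as multisets of intervals), where $\alpha B'+\delta:=\{(\alpha b_i'+\delta,\alpha d_i'+\delta): i\in[n]\}$.
   Context: $[n]=\{1,\ldots,n\}$. A barcode with $n$ bars is a finite multiset of intervals on the real line $B=\{(b_i,d_i)\}_{i=1}^n$ with $b_i<d_i$ for all $i\in[n]$; the indexing by $[n]$ is a choice of labeling. For an integer $k\ge 0$, $B$ is $k$-strict if the sets $\{b_i+\ell\frac{d_i-b_i}{2^k}:\ell=0,\ldots,2^k\}$ and $\{b_j+\ell\frac{d_j-b_j}{2^k}:\ell=0,\ldots,2^k\}$ are disjoint for all $i\ne j$. $B$ is fundamentally strict if it is $k$-strict for every integer $k\ge 0$. $L((2^k+1)^n)$ is the set of all permutations (words) of the multiset in which each of $1,\ldots,n$ has multiplicity $2^k+1$. For a $k$-strict barcode $B$, the $n(2^k+1)$ points $b_i+\ell\frac{d_i-b_i}{2^k}$ ($i\in[n]$, $0\le\ell\le 2^k$) are distinct; list them in increasing order and let $f_k(B)\in L((2^k+1)^n)$ be the word whose $r$-th letter is the index $i$ of the bar from which the $r$-th smallest point comes. $\mathfrak{S}_n$ acts on $L((2^k+1)^n)$ by applying a permutation to every letter, and $g_k(B)=[f_k(B)]\in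 L((2^k+1)^n)/\mathfrak{S}_n$ is the orbit of $f_k(B)$; it does not depend on the labeling of the bars. The interval graph $G_B$ of $B$ is the simple graph with vertex set $[n]$ in which distinct $i,j$ are adjacent if and only if $(b_i,d_i)\cap(b_j,d_j)\neq\emptyset$. *)

theory Defs
  imports
    Complex_Main
    "HOL-Library.Multiset"
    "HOL-Library.Disjoint_Sets"
    "HOL-Combinatorics.Multiset_Permutations"
    "HOL-Algebra.Sym_Groups"
    "HOL-Algebra.Group_Action"
    "Graph_Theory.Digraph_Component"
begin

text \<open>
  A labelled barcode with \<open>n\<close> bars is a function \<open>B\<close> whose values \<open>B i = (b\<^sub>i, d\<^sub>i)\<close>
  are relevant only for \<open>i \<in> {1..n}\<close>; the pair stands for the open interval with these
  endpoints. The barcode itself, with the labelling forgotten, is \<open>bars n B\<close>.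
\<close>

type_synonym lbarcode = "nat \<Rightarrow> real \<times> real"

definition is_barcode :: "nat \<Rightarrow> lbarcode \<Rightarrow> bool" where
  "is_barcode n B \<longleftrightarrow> (\<forall>i\<in>{1..n}. fst (B i) < snd (B i))"

definition bars :: "nat \<Rightarrow> lbarcode \<Rightarrow> (real \<times> real) multiset" where
  "bars n B = image_mset B (mset_set {1..n})"

definition affine_barcode :: "real \<Rightarrow> real \<Rightarrow> lbarcode \<Rightarrow> lbarcode" where
  "affine_barcode \<alpha> \<delta> B = (\<lambda>i. (\<alpha> * fst (B i) + \<delta>, \<alpha> * snd (B i) + \<delta>))"

definition bar_points :: "nat \<Rightarrow> real \<times> real \<Rightarrow> real set" where
  "bar_points k I = (\<lambda>l. fst I + real l * ((snd I - fst I) / 2 ^ k)) ` {0..2 ^ k}"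

definition k_strict :: "nat \<Rightarrow> nat \<Rightarrow> lbarcode \<Rightarrow> bool" where
  "k_strict k n B \<longleftrightarrow> disjoint_family_on (\<lambda>i. bar_points k (B i)) {1..n}"

definition fundamentally_strict :: "nat \<Rightarrow> lbarcode \<Rightarrow> bool" where
  "fundamentally_strict n B \<longleftrightarrow> (\<forall>k. k_strict k n B)"

text \<open>
  The word \<open>f\<^sub>k(B)\<close>. The description of a letter by \<open>THE\<close> is meaningful when \<open>B\<close> is
  \<open>k\<close>-strict, since then every point belongs to exactly one bar.
\<close>

definition bar_word :: "nat \<Rightarrow> nat \<Rightarrow> lbarcode \<Rightarrow> nat list" where
  "bar_word k n B =
     map (\<lambda>x. THE i. i \<in> {1..n} \<and> x \<in> bar_points k (B i))
       (sorted_list_of_set (\<Union>i\<in>{1..n}. bar_points k (B i)))"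

definition words :: "nat \<Rightarrow> nat \<Rightarrow> nat list set" where
  "words k n = permutations_of_multiset (\<Sum>i\<in>{1..n}. replicate_mset (2 ^ k + 1) i)"

text \<open>The orbit \<open>g\<^sub>k(B)\<close>: a permutation acts on a word by \<^const>\<open>map\<close>, letter by letter.\<close>

definition bar_orbit :: "nat \<Rightarrow> nat \<Rightarrow> lbarcode \<Rightarrow> nat list set" where
  "bar_orbit k n B = Group_Action.orbit (sym_group n) map (bar_word k n B)"

text \<open>Simple graphs are irreflexive symmetric digraphs without parallel arcs.\<close>

definition interval_graph :: "nat \<Rightarrow> lbarcode \<Rightarrow> nat pair_pre_digraph" where
  "interval_graph n B =
     \<lparr> pverts = {1..n},
       parcs = {(i, j). i \<in> {1..n} \<and> j \<in> {1..n} \<and> i \<noteq> j \<and>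
         {fst (B i)<..<snd (B i)} \<inter> {fst (B j)<..<snd (B j)} \<noteq> {}} \<rparr>"

lemma pair_graph_interval_graph: "pair_graph (interval_graph n B)"
proof
  show "finite (parcs (interval_graph n B))"
    by (rule finite_subset[of _ "{1..n} \<times> {1..n}"]) (auto simp: interval_graph_def)
  show "symmetric (with_proj (interval_graph n B))"
    by (auto simp: interval_graph_def symmetric_def sym_def)
qed (auto simp: interval_graph_def)

lemma card_bar_points:
  assumes "fst I < snd I"
  shows "card (bar_points k I) = 2 ^ k + 1"
proof -
  have "inj_on (\<lambda>l. fst I + real l * ((snd I - fst I) / 2 ^ k)) {0..2 ^ k}"
    using assms by (auto intro!: inj_onI)
  then show ?thesis
    by (simp add: bar_points_def card_image)
qed

lemma bar_word_in_words:
  assumes "is_barcode n B" "k_strict k n B"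
  shows "bar_word k n B \<in> words k n"
proof -
  let ?P = "\<lambda>i. bar_points k (B i)"
  let ?own = "\<lambda>x. THE i. i \<in> {1..n} \<and> x \<in> ?P i"
  have own: "?own x = i" if "i \<in> {1..n}" "x \<in> ?P i" for x i
    using that assms(2) unfolding k_strict_def disjoint_family_on_def
    by (intro the_equality) blast+
  have fin: "finite (?P i)" for i
    by (simp add: bar_points_def)
  define A where "A = (\<Union>i\<in>{1..n}. ?P i)"
  have count_image: "count (image_mset g (mset_set S)) i = card {x \<in> S. g x = i}"
    if "finite S" for g :: "real \<Rightarrow> nat" and S i
    using that by (induction S rule: finite_induct) (auto simp: Collect_conv_if conj_disj_distribR Collect_disj_eq)
  have mset: "mset (bar_word k n B) = image_mset ?own (mset_set A)"
    unfolding bar_word_def mset_map A_def[symmetric]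
    by (simp only: mset_sorted_list_of_multiset sorted_list_of_mset_set[symmetric])
  have "count (mset (bar_word k n B)) i
      = count (\<Sum>j\<in>{1..n}. replicate_mset (2 ^ k + 1) j) i" for i
  proof -
    have "{x \<in> A. ?own x = i} = (if i \<in> {1..n} then ?P i else {})"
    proof (rule Set.set_eqI)
      fix x
      show "x \<in> {x \<in> A. ?own x = i} \<longleftrightarrow> x \<in> (if i \<in> {1..n} then ?P i else {})"
      proof (cases "x \<in> A")
        case True
        then obtain j where j: "j \<in> {1..n}" "x \<in> ?P j"
          unfolding A_def by blast
        show ?thesis
          using True j own[OF j] own[of i x] by (cases "i \<in> {1..n}") force+
      next
        case False
        then show ?thesis
          unfolding A_def by (cases "i \<in> {1..n}") auto
      qed
    qed
    then have "count (mset (bar_word k n B)) i = card (if i \<in> {1..n} then ?P i else {})"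
      using fin by (simp only: mset count_image A_def finite_UN_I finite_atLeastAtMost)
    also have "\<dots> = (if i \<in> {1..n} then 2 ^ k + 1 else 0)"
      using assms(1) unfolding is_barcode_def by (auto simp: card_bar_points)
    also have "\<dots> = count (\<Sum>j\<in>{1..n}. replicate_mset (2 ^ k + 1) j) i"
      by (simp only: count_sum count_replicate_mset) (simp only: sum.delta' finite_atLeastAtMost)
    finally show ?thesis .
  qed
  then show ?thesis
    unfolding words_def by (intro permutations_of_multisetI multiset_eqI)
qed

lemma bar_orbit_relabel:
  assumes \<sigma>: "\<sigma> permutes {1..n}" and "k_strict k n B"
  shows "bar_orbit k n (B \<circ> \<sigma>) = bar_orbit k n B"
proof -
  let ?P = "\<lambda>i. bar_points k (B i)"
  let ?\<rho> = "inv_into UNIV \<sigma>"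
  have \<sigma>': "?\<rho> permutes {1..n}"
    using \<sigma> by (rule permutes_inv)
  have points: "(\<Union>i\<in>{1..n}. ?P (\<sigma> i)) = (\<Union>i\<in>{1..n}. ?P i)"
    using permutes_image[OF \<sigma>] image_image[of ?P \<sigma> "{1..n}"] by simp
  have own: "(THE i. i \<in> {1..n} \<and> x \<in> ?P (\<sigma> i)) = ?\<rho> (THE i. i \<in> {1..n} \<and> x \<in> ?P i)"
    if x: "x \<in> (\<Union>i\<in>{1..n}. ?P i)" for x
  proof -
    obtain j where j: "j \<in> {1..n}" "x \<in> ?P j"
      using x by blast
    have uniq: "i = j" if "i \<in> {1..n}" "x \<in> ?P i" for i
      using that j assms(2) unfolding k_strict_def disjoint_family_on_def by blast
    have "(THE i. i \<in> {1..n} \<and> x \<in> ?P i) = j"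
      using j uniq by (intro the_equality) blast+
    moreover have "(THE i. i \<in> {1..n} \<and> x \<in> ?P (\<sigma> i)) = ?\<rho> j"
    proof (rule the_equality)
      show "?\<rho> j \<in> {1..n} \<and> x \<in> ?P (\<sigma> (?\<rho> j))"
        using j permutes_in_image[OF \<sigma>'] permutes_inverses(1)[OF \<sigma>] by simp
    next
      fix i assume i: "i \<in> {1..n} \<and> x \<in> ?P (\<sigma> i)"
      then have "\<sigma> i = j"
        using uniq permutes_in_image[OF \<sigma>] by blast
      then show "i = ?\<rho> j"
        using permutes_inverses(2)[OF \<sigma>, of i] by simp
    qed
    ultimately show ?thesis by simp
  qed
  have "bar_word k n (B \<circ> \<sigma>) = map (?\<rho>) (bar_word k n B)"
    unfolding bar_word_def map_map comp_def points
    by (rule map_cong[OF refl]) (use own in \<open>simp add: bar_points_def\<close>)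
  moreover have "{map \<tau> (map (?\<rho>) w) |\<tau>. \<tau> permutes {1..n}} =
      {map \<tau> w |\<tau>. \<tau> permutes {1..n}}" for w :: "nat list"
  proof safe
    fix \<tau> assume \<tau>: "\<tau> permutes {1..n}"
    have "map \<tau> (map (?\<rho>) w) = map (\<tau> \<circ> ?\<rho>) w"
      by simp
    then show "\<exists>\<tau>'. map \<tau> (map (?\<rho>) w) = map \<tau>' w \<and> \<tau>' permutes {1..n}"
      using permutes_compose[OF \<sigma>' \<tau>] by blast
  next
    fix \<tau> assume \<tau>: "\<tau> permutes {1..n}"
    have "map \<tau> w = map (\<tau> \<circ> \<sigma>) (map (?\<rho>) w)"
      using permutes_inverses(1)[OF \<sigma>] by simp
    then show "\<exists>\<tau>'. map \<tau> w = map \<tau>' (map (?\<rho>) w) \<and> \<tau>' permutes {1..n}"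
      using permutes_compose[OF \<sigma> \<tau>] by blast
  qed
  ultimately show ?thesis
    by (simp add: bar_orbit_def Group_Action.orbit_def sym_group_def)
qed

end

theory Submission
  imports Defs
begin

text \<open>
  Parametrise every bar affinely by \<open>[0,1]\<close>. There are only finitely many relabellings,
  so a single one matches the words \<open>f\<^sub>k\<close> for infinitely many \<open>k\<close>; after it,
  the bars of the two barcodes at dyadic parameters are ordered in the same way. If two bars
  overlap, density of the dyadic numbers determines the affine transition map between their
  parametrisations on a nontrivial interval, hence everywhere, so the affine maps that
  carry the two bars of \<open>B'\<close> to those of \<open>B\<close> coincide. Connectedness of the
  interval graph makes this map the same for all bars.
\<close>

section \<open>Parametrised bars and the words they produce\<close>

definition bar_param :: "real \<times> real \<Rightarrow> real \<Rightarrow> real" where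
  "bar_param I t = fst I + t * (snd I - fst I)"

definition dyadics01 :: "real set" where
  "dyadics01 = {real l / 2 ^ k | l k. l \<le> 2 ^ k}"

lemma bar_param_less_iff:
  assumes "fst I < snd I"
  shows "bar_param I s < bar_param I t \<longleftrightarrow> s < t"
  using assms by (simp add: bar_param_def)

lemma bar_points_conv_param:
  "bar_points k I = set (map (\<lambda>l. bar_param I (real l / 2 ^ k)) [0..<2 ^ k + 1])"
  by (simp only: bar_points_def bar_param_def set_map set_upt atLeastLessThanSuc_atLeastAtMost
      Suc_eq_plus1[symmetric]) (simp add: field_simps)

lemma sorted_wrt_map_bar_param:
  assumes "fst I < snd I"
  shows "sorted_wrt (<) (map (\<lambda>l. bar_param I (real l / 2 ^ k)) [0..<m])"
  using assms by (simp add: sorted_wrt_iff_nth_less bar_param_less_iff divide_strict_right_mono)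

text \<open>Strictness gives each point a unique owner, so the \<open>THE\<close> in
  \<open>bar_word\<close> can be traded for membership once and for all.\<close>

lemma nth_bar_word_eq_iff:
  fixes k n B
  defines "xs \<equiv> sorted_list_of_set (\<Union>i\<in>{1..n}. bar_points k (B i))"
  assumes "k_strict k n B" and "p < length xs" and "i \<in> {1..n}"
  shows "bar_word k n B ! p = i \<longleftrightarrow> xs ! p \<in> bar_points k (B i)"
proof -
  have fin: "finite (\<Union>i\<in>{1..n}. bar_points k (B i))"
    by (simp add: bar_points_def)
  have own: "(THE i. i \<in> {1..n} \<and> x \<in> bar_points k (B i)) = j"
    if "j \<in> {1..n}" "x \<in> bar_points k (B j)" for x j
    using that assms(2) unfolding k_strict_def disjoint_family_on_def
    by (intro the_equality) blast+
  have "xs ! p \<in> (\<Union>i\<in>{1..n}. bar_points k (B i))"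
    using nth_mem[OF assms(3)] unfolding xs_def set_sorted_list_of_set[OF fin] .
  then obtain j where j: "j \<in> {1..n}" "xs ! p \<in> bar_points k (B j)"
    by blast
  have "bar_word k n B ! p = j"
    using own[OF j] assms(3) by (simp add: bar_word_def xs_def)
  then show ?thesis
    using j own[of i "xs ! p"] own[of j "xs ! p"] assms(4) by metis
qed

text \<open>The points found at the occurrences of the letter \<open>i\<close>, and the points of
  bar \<open>i\<close> by increasing parameter, are strictly sorted lists with the same set, hence
  equal. So occurrence \<open>l\<close>, counted from 0, has parameter \<open>l / 2 ^ k\<close>, and
  the word alone gives its rank among all points.\<close>

lemma bar_param_position:
  fixes k n B i
  defines "xs \<equiv> sorted_list_of_set (\<Union>i\<in>{1..n}. bar_points k (B i))"
    and "ps \<equiv> filter (\<lambda>p. bar_word k n B ! p = i) [0..<length (bar_word k n B)]"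
  assumes "is_barcode n B" and "k_strict k n B" and "i \<in> {1..n}" and "l \<le> 2 ^ k"
  shows "ps ! l < length xs" and "xs ! (ps ! l) = bar_param (B i) (real l / 2 ^ k)"
proof -
  let ?ys = "map (\<lambda>l. bar_param (B i) (real l / 2 ^ k)) [0..<2 ^ k + 1]"
  have fin: "finite (\<Union>i\<in>{1..n}. bar_points k (B i))"
    by (simp add: bar_points_def)
  have len: "length (bar_word k n B) = length xs"
    by (simp add: bar_word_def xs_def)
  have xs: "sorted_wrt (<) xs"
    by (simp add: xs_def)
  have ps_set: "set ps = {p. p < length xs \<and> xs ! p \<in> bar_points k (B i)}"
    using nth_bar_word_eq_iff[OF assms(4), folded xs_def, OF _ assms(5)]
    unfolding ps_def len by auto
  have "sorted_wrt (<) ps"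
    by (simp add: ps_def sorted_wrt_filter)
  then have "sorted_wrt (<) (map ((!) xs) ps)"
    unfolding sorted_wrt_map
    using xs ps_set by (auto intro: sorted_wrt_mono_rel[rotated] sorted_wrt_nth_less)
  moreover have "sorted_wrt (<) ?ys"
    using assms(3,5) by (intro sorted_wrt_map_bar_param) (auto simp: is_barcode_def)
  moreover have "set (map ((!) xs) ps) = set ?ys"
  proof -
    have "bar_points k (B i) \<subseteq> set xs"
      using assms(5) unfolding xs_def set_sorted_list_of_set[OF fin] by blast
    then have "(!) xs ` set ps = bar_points k (B i)"
      unfolding ps_set by (force simp: in_set_conv_nth)
    then show ?thesis
      by (simp only: set_map[of "(!) xs"] bar_points_conv_param)
  qed
  ultimately have eq: "map ((!) xs) ps = ?ys"
    by (intro sorted_distinct_set_unique) (auto simp: strict_sorted_iff)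
  have "length ps = 2 ^ k + 1"
    using arg_cong[OF eq, of length] by simp
  then have l: "l < length ps"
    using assms(6) by simp
  show "ps ! l < length xs"
    using nth_mem[OF l] ps_set by blast
  have "xs ! (ps ! l) = map ((!) xs) ps ! l"
    using l by simp
  also have "\<dots> = ?ys ! l"
    by (simp only: eq)
  also have "\<dots> = bar_param (B i) (real l / 2 ^ k)"
    using assms(6) by (subst nth_map) (auto simp del: upt_Suc)
  finally show "xs ! (ps ! l) = bar_param (B i) (real l / 2 ^ k)" .
qed

text \<open>Points compare as their ranks do, and ranks are positions in the word. Relabelling moves
  no position: \<open>\<tau> i\<close> occurs in one word exactly where \<open>i\<close> occurs in
  the other, so the same two positions decide both comparisons.\<close>

lemma bar_word_order:
  assumes "is_barcode n B" "is_barcode n B'" "k_strict k n B" "k_strict k n B'"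
    and \<tau>: "\<tau> permutes {1..n}" and word: "bar_word k n B = map \<tau> (bar_word k n B')"
    and "i \<in> {1..n}" "j \<in> {1..n}" "l \<le> 2 ^ k" "m \<le> 2 ^ k"
  shows "bar_param (B (\<tau> i)) (real l / 2 ^ k) < bar_param (B (\<tau> j)) (real m / 2 ^ k)
    \<longleftrightarrow> bar_param (B' i) (real l / 2 ^ k) < bar_param (B' j) (real m / 2 ^ k)"
proof -
  define xs where "xs = sorted_list_of_set (\<Union>i\<in>{1..n}. bar_points k (B i))"
  define xs' where "xs' = sorted_list_of_set (\<Union>i\<in>{1..n}. bar_points k (B' i))"
  define ps where "ps i = filter (\<lambda>p. bar_word k n B' ! p = i) [0..<length (bar_word k n B')]" for i
  have ps: "filter (\<lambda>p. bar_word k n B ! p = \<tau> i) [0..<length (bar_word k n B)] = ps i" for i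
    using permutes_inj[OF \<tau>] unfolding ps_def word
    by (auto simp: inj_eq intro!: filter_cong)
  have \<tau>_in: "\<tau> i \<in> {1..n}" if "i \<in> {1..n}" for i
    using that permutes_in_image[OF \<tau>] by blast
  have pos: "ps i ! l < length xs" "xs ! (ps i ! l) = bar_param (B (\<tau> i)) (real l / 2 ^ k)"
      "ps i ! l < length xs'" "xs' ! (ps i ! l) = bar_param (B' i) (real l / 2 ^ k)"
    if "i \<in> {1..n}" "l \<le> 2 ^ k" for i l
    using bar_param_position[OF assms(1,3) \<tau>_in[OF that(1)] that(2)]
      bar_param_position[OF assms(2,4) that]
    by (simp_all only: ps xs_def xs'_def ps_def)
  have mono: "zs ! p < zs ! q \<longleftrightarrow> p < q"
    if "sorted_wrt (<) zs" "p < length zs" "q < length zs" for zs :: "real list" and p q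
    using that by (metis linorder_neqE_nat order_less_asym order_less_irrefl sorted_wrt_nth_less)
  have "sorted_wrt (<) xs" "sorted_wrt (<) xs'"
    by (simp_all add: xs_def xs'_def)
  then show ?thesis
    using mono pos[OF assms(7,9)] pos[OF assms(8,10)] by metis
qed

section \<open>Dyadic numbers in the unit interval\<close>

lemma dyadics01_common_level:
  assumes "infinite K" "s \<in> dyadics01" "t \<in> dyadics01"
  obtains k l m where "k \<in> K" "l \<le> 2 ^ k" "m \<le> 2 ^ k" "s = real l / 2 ^ k" "t = real m / 2 ^ k"
proof -
  obtain l a m b where s: "s = real l / 2 ^ a" "l \<le> 2 ^ a" and t: "t = real m / 2 ^ b" "m \<le> 2 ^ b"
    using assms(2,3) unfolding dyadics01_def by blast
  obtain k where k: "k \<in> K" "max a b \<le> k"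
    using assms(1) by (meson infinite_nat_iff_unbounded_le)
  \<comment> \<open>A dyadic fraction can be expanded to any finer level, so a level of
    \<open>K\<close> beyond both denominators serves both.\<close>
  have refine: "l * 2 ^ (k - a) \<le> 2 ^ k \<and> real l / 2 ^ a = real (l * 2 ^ (k - a)) / 2 ^ k"
    if "l \<le> 2 ^ a" "a \<le> k" for l a
  proof -
    have "(2::nat) ^ k = 2 ^ a * 2 ^ (k - a)" "(2::real) ^ k = 2 ^ a * 2 ^ (k - a)"
      using that(2) by (simp_all flip: power_add)
    then show ?thesis
      using that(1) by simp
  qed
  show thesis
    by (rule that[OF k(1), of "l * 2 ^ (k - a)" "m * 2 ^ (k - b)"])
      (use refine[of l a] refine[of m b] s t k in auto)
qed

lemma dyadics01_dense:
  assumes "0 \<le> x" "x < y" "y \<le> 1"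
  obtains t where "t \<in> dyadics01" "x < t" "t < y"
proof -
  obtain k where "(1 / 2) ^ k < y - x"
    using real_arch_pow_inv[of "y - x" "1 / 2"] assms by auto
  then have k: "1 < (y - x) * 2 ^ k"
    by (simp add: power_divide field_simps)
  \<comment> \<open>The least integer above \<open>x * 2 ^ k\<close>; as the mesh is finer than
    \<open>y - x\<close>, it stays below \<open>y * 2 ^ k\<close>.\<close>
  define l where "l = nat (\<lfloor>x * 2 ^ k\<rfloor> + 1)"
  have "real l = of_int \<lfloor>x * 2 ^ k\<rfloor> + 1"
    using assms by (simp add: l_def)
  then have l: "x * 2 ^ k < real l" "real l < y * 2 ^ k"
    using k by (simp_all add: algebra_simps) linarith+
  have "y * 2 ^ k \<le> 2 ^ k"
    using assms by simp
  then have "real l \<le> 2 ^ k"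
    using l by linarith
  then have "l \<le> 2 ^ k"
    by simp
  then have "real l / 2 ^ k \<in> dyadics01"
    unfolding dyadics01_def by blast
  then show thesis
    by (rule that) (use l in \<open>simp_all add: field_simps\<close>)
qed

section \<open>Affine maps between corresponding bars\<close>

lemma bar_param_surj:
  assumes "fst I < snd I"
  obtains t where "x = bar_param I t"
  using assms by (intro that[of "(x - fst I) / (snd I - fst I)"]) (simp add: bar_param_def)

text \<open>A Dedekind cut argument: the dyadic parameters beyond a point locate it, provided it is
  interior to the bar.\<close>

lemma bar_param_matching:
  assumes "fst J < snd J" "fst J' < snd J'"
    and order: "\<And>t. t \<in> dyadics01 \<Longrightarrow> x < bar_param J t \<longleftrightarrow> x' < bar_param J' t"
    and "0 < u" "u < 1" "x = bar_param J u"
  shows "x' = bar_param J' u"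
proof -
  obtain u' where u': "x' = bar_param J' u'"
    using bar_param_surj[OF assms(2)] .
  have order': "u < t \<longleftrightarrow> u' < t" if "t \<in> dyadics01" for t
    using order[OF that] assms(1,2,6) u' by (simp add: bar_param_less_iff)
  have "\<not> u < u'"
  proof
    assume "u < u'"
    \<comment> \<open>\<open>u'\<close> may lie outside the unit interval, so the gap is truncated
      first; it stays nonempty because \<open>u < 1\<close>.\<close>
    then obtain t where "t \<in> dyadics01" "u < t" "t < min u' 1"
      using dyadics01_dense[of u "min u' 1"] assms(4,5) by auto
    then show False
      using order' by fastforce
  qed
  moreover have "\<not> u' < u"
  proof
    assume "u' < u"
    then obtain t where "t \<in> dyadics01" "max u' 0 < t" "t < u"
      using dyadics01_dense[of "max u' 0" u] assms(4,5) by auto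
    then show False
      using order' by fastforce
  qed
  ultimately show ?thesis
    using u' by simp
qed

text \<open>With \<open>bar_shift\<close>, the slope and intercept of the affine map carrying
  \<open>I'\<close> onto \<open>I\<close>.\<close>

definition bar_scale :: "real \<times> real \<Rightarrow> real \<times> real \<Rightarrow> real" where
  "bar_scale I I' = (snd I - fst I) / (snd I' - fst I')"

definition bar_shift :: "real \<times> real \<Rightarrow> real \<times> real \<Rightarrow> real" where
  "bar_shift I I' = fst I - bar_scale I I' * fst I'"

lemma bar_scale_shift_param:
  assumes "fst I' < snd I'"
  shows "bar_scale I I' * bar_param I' t + bar_shift I I' = bar_param I t"
proof -
  have "bar_scale I I' * (snd I' - fst I') = snd I - fst I"
    using assms by (simp add: bar_scale_def)
  then show ?thesis
    by (simp add: bar_shift_def bar_param_def) algebra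
qed

text \<open>A point common to \<open>I\<close> and \<open>J\<close> comes from a point common to
  \<open>I'\<close> and \<open>J'\<close> with the same two parameters, so both affine maps take the
  same value there. Two such points determine an affine map.\<close>

lemma overlapping_bars_same_affine_map:
  assumes I: "fst I < snd I" and J: "fst J < snd J" and I': "fst I' < snd I'" and J': "fst J' < snd J'"
    and order: "\<And>s t. s \<in> dyadics01 \<Longrightarrow> t \<in> dyadics01 \<Longrightarrow>
      bar_param I s < bar_param J t \<longleftrightarrow> bar_param I' s < bar_param J' t"
    and overlap: "{fst I<..<snd I} \<inter> {fst J<..<snd J} \<noteq> {}"
  shows "bar_scale I I' = bar_scale J J'" "bar_shift I I' = bar_shift J J'"
proof -
  define lo hi where "lo = max (fst I) (fst J)" and "hi = min (snd I) (snd J)"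
  have "lo < hi"
    using overlap by (auto simp: lo_def hi_def)
  \<comment> \<open>The ends of the overlap in the parameter of \<open>I\<close>: any
    \<open>s\<close> strictly between them is interior to both bars.\<close>
  obtain a c where a: "lo = bar_param I a" and c: "hi = bar_param I c"
    using bar_param_surj[OF I] by metis
  have ends: "fst A = bar_param A 0" "snd A = bar_param A 1" for A
    by (simp_all add: bar_param_def)
  have le: "bar_param I s \<le> bar_param I t \<longleftrightarrow> s \<le> t" for s t
    using bar_param_less_iff[OF I] by (meson linorder_not_less)
  have "bar_param I 0 \<le> lo" "hi \<le> bar_param I 1"
    by (simp_all add: lo_def hi_def flip: ends)
  then have ac: "0 \<le> a" "a < c" "c \<le> 1"
    using \<open>lo < hi\<close> unfolding a c by (simp_all add: le bar_param_less_iff[OF I])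
  obtain s1 where s1: "s1 \<in> dyadics01" "a < s1" "s1 < c"
    using dyadics01_dense[OF ac] .
  obtain s2 where s2: "s2 \<in> dyadics01" "s1 < s2" "s2 < c"
    using dyadics01_dense[of s1 c] s1 ac by auto
  have agree: "bar_scale I I' * bar_param I' s + bar_shift I I' =
      bar_scale J J' * bar_param I' s + bar_shift J J'"
    if s: "s \<in> dyadics01" "a < s" "s < c" for s
  proof -
    \<comment> \<open>\<open>u\<close> need not be dyadic; only the comparison of this point with
      the dyadic points of \<open>J\<close> is known.\<close>
    obtain u where u: "bar_param I s = bar_param J u"
      using bar_param_surj[OF J] .
    have "lo < bar_param I s" "bar_param I s < hi"
      using s by (simp_all add: a c bar_param_less_iff[OF I])
    then have "bar_param J 0 < bar_param J u" "bar_param J u < bar_param J 1"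
      by (simp_all add: lo_def hi_def u flip: ends)
    then have "0 < u" "u < 1"
      by (simp_all add: bar_param_less_iff[OF J])
    from bar_param_matching[OF J J' order[OF s(1)] this u]
    have "bar_param I' s = bar_param J' u" .
    then show ?thesis
      using bar_scale_shift_param[OF I'] bar_scale_shift_param[OF J'] u by metis
  qed
  have ne: "bar_param I' s1 \<noteq> bar_param I' s2"
    using bar_param_less_iff[OF I'] s2 by (metis order_less_irrefl)
  have "(bar_scale I I' - bar_scale J J') * (bar_param I' s1 - bar_param I' s2) = 0"
    using agree[of s1] agree[of s2] s1 s2 by (simp add: algebra_simps)
  then show "bar_scale I I' = bar_scale J J'"
    using ne by simp
  then show "bar_shift I I' = bar_shift J J'"
    using agree[OF s1] by simp
qed

section \<open>One relabelling, and propagation along the interval graph\<close>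

lemma frequent_relabelling:
  assumes "\<And>k. bar_orbit k n B = bar_orbit k n B'"
  obtains \<tau> where "\<tau> permutes {1..n}" "infinite {k. bar_word k n B = map \<tau> (bar_word k n B')}"
proof -
  have "\<exists>\<tau>. \<tau> permutes {1..n} \<and> bar_word k n B = map \<tau> (bar_word k n B')" for k
  proof -
    \<comment> \<open>The identity puts the word in its own orbit, hence in that of the other
      word.\<close>
    have "map id (bar_word k n B) \<in> bar_orbit k n B"
      unfolding bar_orbit_def Group_Action.orbit_def sym_group_def using permutes_id by fastforce
    then show ?thesis
      unfolding assms by (auto simp: bar_orbit_def Group_Action.orbit_def sym_group_def)
  qed
  then obtain \<tau> where \<tau>: "\<tau> k permutes {1..n}"
      "bar_word k n B = map (\<tau> k) (bar_word k n B')" for k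
    by metis
  have "finite (range \<tau>)"
    by (rule finite_subset[OF _ finite_permutations[of "{1..n}"]]) (use \<tau> in auto)
  then obtain k where "infinite {j \<in> UNIV. \<tau> j = \<tau> k}"
    using pigeonhole_infinite[of UNIV \<tau>] by auto
  then have "infinite {j. bar_word j n B = map (\<tau> k) (bar_word j n B')}"
    by (rule contrapos_nn) (erule finite_subset[rotated], use \<tau> in \<open>auto intro: \<tau>(2)[THEN trans]\<close>)
  then show thesis
    using that \<tau> by blast
qed

lemma connected_interval_graph_constant:
  assumes "Digraph_Component.connected (with_proj (interval_graph n B))"
    and adjacent: "\<And>i j. i \<in> {1..n} \<Longrightarrow> j \<in> {1..n} \<Longrightarrow>
      {fst (B i)<..<snd (B i)} \<inter> {fst (B j)<..<snd (B j)} \<noteq> {} \<Longrightarrow> f i = f j"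
    and "i \<in> {1..n}" "j \<in> {1..n}"
  shows "f i = f j"
proof -
  have "i \<rightarrow>\<^sup>*\<^bsub>mk_symmetric (with_proj (interval_graph n B))\<^esub> j"
    using assms by (auto simp: Digraph_Component.connected_def strongly_connected_def interval_graph_def)
  then have "(i, j) \<in> (parcs (mk_symmetric (with_proj (interval_graph n B))))\<^sup>*"
    by (auto dest: reachable_rtranclI)
  then show ?thesis
  proof (induction rule: rtrancl_induct)
    case (step u v)
    \<comment> \<open>A step in the symmetrised graph may come from an arc in either
      direction.\<close>
    then have "f u = f v"
      using adjacent[of u v] adjacent[of v u] by (auto simp: parcs_mk_symmetric interval_graph_def)
    then show ?case
      using step.IH by simp
  qed (rule refl)
qed

theorem theorem3:
  fixes n :: nat and B B' :: lbarcode
  assumes "is_barcode n B" and "is_barcode n B'"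
    and "fundamentally_strict n B" and "fundamentally_strict n B'"
    and "\<And>k::nat. bar_orbit k n B = bar_orbit k n B'"
    and "Digraph_Component.connected (with_proj (interval_graph n B))"
  shows "\<exists>\<alpha> \<delta>::real. \<alpha> > 0 \<and> bars n B = bars n (affine_barcode \<alpha> \<delta> B')"
proof -
  obtain \<tau> where \<tau>: "\<tau> permutes {1..n}"
    and inf: "infinite {k. bar_word k n B = map \<tau> (bar_word k n B')}"
    using frequent_relabelling assms(5) by blast
  \<comment> \<open>Bar \<open>i\<close> of \<open>B\<close> is matched with bar
    \<open>?\<rho> i\<close> of \<open>B'\<close>; labels of \<open>B\<close> are kept because
    connectivity is assumed for its graph.\<close>
  let ?\<rho> = "inv_into UNIV \<tau>"
  have \<rho>: "?\<rho> i \<in> {1..n}" if "i \<in> {1..n}" for i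
    using that permutes_in_image[OF permutes_inv[OF \<tau>]] by blast
  have \<tau>\<rho>: "\<tau> (?\<rho> i) = i" for i
    using permutes_inverses(1)[OF \<tau>] .
  have order: "bar_param (B i) s < bar_param (B j) t \<longleftrightarrow>
      bar_param (B' (?\<rho> i)) s < bar_param (B' (?\<rho> j)) t"
    if ij: "i \<in> {1..n}" "j \<in> {1..n}" and st: "s \<in> dyadics01" "t \<in> dyadics01" for i j s t
  proof -
    obtain k l m where k: "bar_word k n B = map \<tau> (bar_word k n B')" "l \<le> 2 ^ k" "m \<le> 2 ^ k"
        "s = real l / 2 ^ k" "t = real m / 2 ^ k"
      using dyadics01_common_level[OF inf st] by blast
    have "k_strict k n B" "k_strict k n B'"
      using assms(3,4) by (simp_all add: fundamentally_strict_def)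
    from bar_word_order[OF assms(1,2) this \<tau> k(1) \<rho>[OF ij(1)] \<rho>[OF ij(2)] k(2,3)]
    show ?thesis
      unfolding \<tau>\<rho> k(4,5) .
  qed
  have pos: "fst (B i) < snd (B i)" "fst (B' (?\<rho> i)) < snd (B' (?\<rho> i))" if "i \<in> {1..n}" for i
    using assms(1,2) that \<rho>[OF that] by (auto simp: is_barcode_def)
  let ?f = "\<lambda>i. (bar_scale (B i) (B' (?\<rho> i)), bar_shift (B i) (B' (?\<rho> i)))"
  have const: "?f i = ?f j" if "i \<in> {1..n}" "j \<in> {1..n}" for i j
  proof (rule connected_interval_graph_constant[OF assms(6) _ that, of ?f])
    fix i j
    assume "i \<in> {1..n}" "j \<in> {1..n}" "{fst (B i)<..<snd (B i)} \<inter> {fst (B j)<..<snd (B j)} \<noteq> {}"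
    note * = overlapping_bars_same_affine_map[OF pos(1)[OF this(1)] pos(1)[OF this(2)]
        pos(2)[OF this(1)] pos(2)[OF this(2)] order[OF this(1,2)] this(3)]
    show "?f i = ?f j"
      by (simp only: *)
  qed
  show ?thesis
  proof (cases "n = 0")
    case True
    then show ?thesis
      by (intro exI[of _ 1]) (simp add: bars_def)
  next
    case False
    then have one: "1 \<in> {1..n}"
      by simp
    \<comment> \<open>By \<open>const\<close>, any bar yields the same constants; bar 1 is read
      off.\<close>
    define \<alpha> \<delta> where "\<alpha> = fst (?f 1)" and "\<delta> = snd (?f 1)"
    have "\<alpha> > 0"
      using pos[OF one] by (simp add: \<alpha>_def bar_scale_def)
    have B: "B (\<tau> i) = affine_barcode \<alpha> \<delta> B' i" if "i \<in> {1..n}" for i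
    proof -
      have \<tau>i: "\<tau> i \<in> {1..n}"
        using that permutes_in_image[OF \<tau>] by blast
      have \<rho>\<tau>: "?\<rho> (\<tau> i) = i"
        using permutes_inverses(2)[OF \<tau>] .
      have "\<alpha> = bar_scale (B (\<tau> i)) (B' i)" "\<delta> = bar_shift (B (\<tau> i)) (B' i)"
        using const[OF one \<tau>i] by (simp_all add: \<alpha>_def \<delta>_def \<rho>\<tau>)
      then have "\<alpha> * bar_param (B' i) t + \<delta> = bar_param (B (\<tau> i)) t" for t
        using bar_scale_shift_param pos(2)[OF \<tau>i] by (simp add: \<rho>\<tau>)
      \<comment> \<open>Parameters 0 and 1 are the two endpoints.\<close>
      from this[of 0] this[of 1] show ?thesis
        by (simp add: affine_barcode_def bar_param_def prod_eq_iff)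
    qed
    \<comment> \<open>Reindexing by a permutation leaves the multiset of bars unchanged.\<close>
    have "bars n B = image_mset B (image_mset \<tau> (mset_set {1..n}))"
      using permutes_inj_on[OF \<tau>] permutes_image[OF \<tau>] by (simp add: bars_def image_mset_mset_set)
    also have "\<dots> = bars n (affine_barcode \<alpha> \<delta> B')"
      using B by (auto simp: bars_def multiset.map_comp intro!: image_mset_cong)
    finally show ?thesis
      using \<open>\<alpha> > 0\<close> by blast
  qed
qed

end
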